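(* Let $i=\sqrt{-1}$, $R_G:=\mathbb{Z}[i]$, $K_G:=\mathbb{Q}(i)$. Let $D:=\{x+iy\in R_G: -1\le x\le 1,\,-1\le y\le 1\}$ and $G_2(1):=D\cup\{\pm2\}$, $G_2(i):=D\cup\{\pm(1+2i),\pm(2+i)\}$, $G_2(-1):=D\cup\{\pm 2i\}$, $G_2(-i):=D\cup\{\pm(1-2i),\pm(2-i)\}$, and $G_3(u):=G_2(u)\cup\{\pm2,\pm2i\}$. Let $u\in\{\pm1,\pm i\}$ and $t\in R_G\setminus G_2(u)$, and let $f(X)=X^2-tX+u$. Define $h_0:=t$, $h_{n+1}:=h_n^2-2u^{2^n}$ ($n\ge0$), $S_n(t,u):=\sum_{0\le m\le n}\frac{u^{2^m}}{h_0h_1\cdots h_m}$, let $F(x):=\frac{x^2-u}{2x-t}$ (the Newton iterator of $f$), $F^{(0)}(x):=x$, and $F^{(n)}$ its $n$-fold iterate. Put $a_n:=u^{-1}t$ for odd $n\ge1$, $a_n:=-t$ for even $n\ge2$; $b_n:=t$ for even $n\ge0$, $b_n:=-u^{-1}t$ for odd $n\ge1$. Then: (1) $f$ is irreducible over $K_G$ and has two roots $\alpha,\beta$ with $|\alpha|<1/2$ and $|\beta-t|<1/2$; (2) the Hurwitz ($HCF_G$) continued fraction expansions are $\alpha=(HCF_G)[0;a_1,a_2,\ldots]$ and $\beta=(HCF_G)[b_0;b_1,b_2,\ldots]$; (3) for all $n\ge0$, $F^{(n+1)}(0)=S_n(t,u)=[0;a_1,a_2,\ldots,a_{2^{n+1}-1}]$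 and $F^{(n+1)}(t)=t-S_n(t,u)=[b_0;b_1,\ldots,b_{2^{n+1}-1}]$; (4) if moreover $t\in R_G\setminus G_3(u)$, then for all $n\ge1$, $|\alpha-F^{(n)}(0)|<\frac{2}{\rho^{2^{n+1}-1}}$ and $|\beta-F^{(n)}(t)|<\frac{2}{\rho^{2^{n+1}-1}}$, where $\rho:=\frac{|t|+\sqrt{|t|^2-4}}{2}>1$.
   Context: $[c_0;c_1,\ldots,c_m]$ denotes the finite continued fraction $c_0+1/(c_1+1/(\cdots+1/c_m))$. For $z=x+iy\in\mathbb{C}$ ($x,y\in\mathbb{R}$) put $[z]_G:=\lfloor x+\tfrac12\rfloor+\lfloor y+\tfrac12\rfloor i\in R_G$ and $\langle z\rangle_G:=z-[z]_G$. The Gauss–Hurwitz ($HCF_G$) expansion of $z\in\mathbb{C}\setminus K_G$ is the sequence obtained by $z_0:=z$, $c_n:=[z_n]_G$, $z_{n+1}:=1/\langle z_n\rangle_G$ for $n\ge0$; one writes $z=(HCF_G)[c_0;c_1,c_2,\ldots]$, and it is known that $[c_0;c_1,\ldots,c_n]\to z$. The statement "$\alpha=(HCF_G)[0;a_1,a_2,\ldots]$" means that this algorithm applied to $\alpha$ produces exactly the digits $0,a_1,a_2,\ldots$. *)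

theory Defs
  imports "HOL-Analysis.Analysis" "HOL-Computational_Algebra.Polynomial"
begin

definition gauss_ints :: "complex set" where
  "gauss_ints = {z. Re z \<in> \<int> \<and> Im z \<in> \<int>}"

definition gauss_rats :: "complex set" where
  "gauss_rats = {z. Re z \<in> \<rat> \<and> Im z \<in> \<rat>}"

text \<open>
  For a subfield \<open>K\<close> of the complex numbers, \<open>polys_over K\<close> is the ring \<open>K[X]\<close>, and
  \<open>irreducible_over K\<close> is irreducibility as an element of that ring. The units are taken
  in \<open>K[X]\<close>, since the library predicate \<open>irreducible\<close> on complex polynomials would refer to
  factorizations over the complex numbers.
\<close>

definition polys_over :: "complex set \<Rightarrow> complex poly set" where
  "polys_over K = {p. \<forall>i. coeff p i \<in> K}"

definition poly_unit_over :: "complex set \<Rightarrow> complex poly \<Rightarrow> bool" where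
  "poly_unit_over K p \<longleftrightarrow> p \<in> polys_over K \<and> (\<exists>q\<in>polys_over K. p * q = 1)"

definition irreducible_over :: "complex set \<Rightarrow> complex poly \<Rightarrow> bool" where
  "irreducible_over K p \<longleftrightarrow>
     p \<in> polys_over K \<and> p \<noteq> 0 \<and> \<not> poly_unit_over K p \<and>
     (\<forall>q\<in>polys_over K. \<forall>r\<in>polys_over K. p = q * r \<longrightarrow> poly_unit_over K q \<or> poly_unit_over K r)"

text \<open>\<open>cfrac c m\<close> is the finite continued fraction \<open>[c 0; c 1, \<dots>, c m]\<close>.\<close>

primrec cfrac :: "(nat \<Rightarrow> complex) \<Rightarrow> nat \<Rightarrow> complex" where
  "cfrac c 0 = c 0"
| "cfrac c (Suc m) = c 0 + 1 / cfrac (\<lambda>k. c (Suc k)) m"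

definition gauss_round :: "complex \<Rightarrow> complex" where
  "gauss_round z = Complex (of_int \<lfloor>Re z + 1/2\<rfloor>) (of_int \<lfloor>Im z + 1/2\<rfloor>)"

definition gauss_frac :: "complex \<Rightarrow> complex" where
  "gauss_frac z = z - gauss_round z"

primrec hcf_remainder :: "complex \<Rightarrow> nat \<Rightarrow> complex" where
  "hcf_remainder z 0 = z"
| "hcf_remainder z (Suc n) = 1 / gauss_frac (hcf_remainder z n)"

text \<open>
  The expansion is defined only for \<open>z\<close> outside \<open>gauss_rats\<close>; there no fractional part
  vanishes, so the division in \<open>hcf_remainder\<close> is genuine.
\<close>

definition has_hcf_expansion :: "complex \<Rightarrow> (nat \<Rightarrow> complex) \<Rightarrow> bool" where
  "has_hcf_expansion z c \<longleftrightarrow>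
     z \<notin> gauss_rats \<and> (\<forall>n. c n = gauss_round (hcf_remainder z n))"

definition D_set :: "complex set" where
  "D_set = {z \<in> gauss_ints. -1 \<le> Re z \<and> Re z \<le> 1 \<and> -1 \<le> Im z \<and> Im z \<le> 1}"

text \<open>Only the values at the four units \<open>u\<close> are meaningful.\<close>

definition G2 :: "complex \<Rightarrow> complex set" where
  "G2 u = D_set \<union>
     (if u = 1 then {2, -2}
      else if u = \<i> then {1 + 2*\<i>, -(1 + 2*\<i>), 2 + \<i>, -(2 + \<i>)}
      else if u = -1 then {2*\<i>, -(2*\<i>)}
      else if u = -\<i> then {1 - 2*\<i>, -(1 - 2*\<i>), 2 - \<i>, -(2 - \<i>)}
      else {})"

definition G3 :: "complex \<Rightarrow> complex set" where
  "G3 u = G2 u \<union> {2, -2, 2*\<i>, -(2*\<i>)}"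

definition f_poly :: "complex \<Rightarrow> complex \<Rightarrow> complex poly" where
  "f_poly t u = [:u, -t, 1:]"

primrec h_seq :: "complex \<Rightarrow> complex \<Rightarrow> nat \<Rightarrow> complex" where
  "h_seq t u 0 = t"
| "h_seq t u (Suc n) = (h_seq t u n)^2 - 2 * u^(2^n)"

definition S_sum :: "complex \<Rightarrow> complex \<Rightarrow> nat \<Rightarrow> complex" where
  "S_sum t u n = (\<Sum>m\<le>n. u^(2^m) / (\<Prod>k\<le>m. h_seq t u k))"

definition newton :: "complex \<Rightarrow> complex \<Rightarrow> complex \<Rightarrow> complex" where
  "newton t u x = (x^2 - u) / (2*x - t)"

definition a_digit :: "complex \<Rightarrow> complex \<Rightarrow> nat \<Rightarrow> complex" where
  "a_digit t u n = (if n = 0 then 0 else if odd n then inverse u * t else - t)"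

definition b_digit :: "complex \<Rightarrow> complex \<Rightarrow> nat \<Rightarrow> complex" where
  "b_digit t u n = (if even n then t else - (inverse u * t))"

definition rho :: "complex \<Rightarrow> real" where
  "rho t = (cmod t + sqrt ((cmod t)^2 - 4)) / 2"

lemma newton_eq_newton_step:
  assumes "2*x \<noteq> t"
  shows "newton t u x = x - poly (f_poly t u) x / poly (pderiv (f_poly t u)) x"
proof -
  have "2*x - t \<noteq> 0" using assms by simp
  thus ?thesis
    by (simp add: newton_def f_poly_def pderiv_pCons divide_simps) (simp add: algebra_simps power2_eq_square)
qed

text \<open>
  The remaining facts show that, under the hypotheses considered here, no denominator
  in \<open>S_sum\<close>, in the iterates of \<open>newton\<close> at \<open>0\<close> and \<open>t\<close>, or in the continued fractions with digits
  \<open>a_digit\<close> and \<open>b_digit\<close> vanishes, so the convention \<open>x / 0 = 0\<close> plays no role.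
\<close>

lemma norm_ge_2:
  assumes "t \<in> gauss_ints - G2 u"
  shows "2 \<le> cmod t"
proof -
  obtain a b :: int where ab: "Re t = of_int a" "Im t = of_int b"
    using assms by (auto simp: gauss_ints_def elim!: Ints_cases)
  have "t \<notin> D_set" "t \<in> gauss_ints" using assms by (auto simp: G2_def)
  hence "\<bar>a\<bar> \<ge> 2 \<or> \<bar>b\<bar> \<ge> 2"
    using ab by (auto simp: D_set_def)
  hence "\<bar>Re t\<bar> \<ge> 2 \<or> \<bar>Im t\<bar> \<ge> 2"
    using ab by linarith
  thus ?thesis
    using abs_Re_le_cmod[of t] abs_Im_le_cmod[of t] by linarith
qed

lemma norm_unit: "u \<in> {1, -1, \<i>, -\<i>} \<Longrightarrow> cmod u = 1"
  by auto

lemma h_nonzero: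
  assumes "u \<in> {1, -1, \<i>, -\<i>}" "t \<in> gauss_ints - G2 u"
  shows "h_seq t u n \<noteq> 0"
proof -
  have "2 \<le> cmod (h_seq t u n)"
  proof (induction n)
    case 0
    show ?case using norm_ge_2[OF assms(2)] by simp
  next
    case (Suc n)
    have "2^2 \<le> (cmod (h_seq t u n))^2"
      using Suc.IH by (intro power_mono) auto
    moreover have "cmod ((h_seq t u n)^2) - cmod (2 * u^(2^n)) \<le> cmod (h_seq t u (Suc n))"
      by (simp only: h_seq.simps norm_triangle_ineq2)
    ultimately show ?case
      using norm_unit[OF assms(1)] by (simp add: norm_power norm_mult)
  qed
  thus ?thesis by auto
qed

lemma h_identity:
  "(h_seq t u n)^2 - (t^2 - 4*u) * (\<Prod>k<n. h_seq t u k)^2 = 4 * u^(2^n)"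
proof (induction n)
  case 0
  show ?case by simp
next
  case (Suc n)
  define p where "p = (\<Prod>k<n. h_seq t u k)"
  define w where "w = u^(2^n)"
  define H where "H = h_seq t u n"
  have "H^2 - (t^2 - 4*u) * p^2 = 4 * w"
    using Suc.IH by (simp add: p_def w_def H_def)
  hence "(H^2 - 2*w)^2 - (t^2 - 4*u) * (p * H)^2 = 4 * w^2"
    by algebra
  moreover have "u^(2^Suc n) = w^2"
    by (simp add: w_def power_mult[symmetric] mult.commute)
  ultimately show ?case
    by (simp add: p_def H_def w_def)
qed

lemma newton_iterate_zero:
  assumes "u \<in> {1, -1, \<i>, -\<i>}" "t \<in> gauss_ints - G2 u"
  shows "2 * (newton t u ^^ n) 0 - t = - h_seq t u n / (\<Prod>k<n. h_seq t u k)"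
proof (induction n)
  case 0
  show ?case by simp
next
  case (Suc n)
  define p where "p = (\<Prod>k<n. h_seq t u k)"
  define w where "w = u^(2^n)"
  define H where "H = h_seq t u n"
  define x where "x = (newton t u ^^ n) 0"
  have nz: "p \<noteq> 0" "H \<noteq> 0"
    using h_nonzero[OF assms] by (auto simp: p_def H_def)
  have id: "H^2 - (t^2 - 4*u) * p^2 = 4 * w"
    using h_identity[of t u n] by (simp add: p_def w_def H_def)
  have IH: "2*x - t = - H / p"
    using Suc.IH by (simp add: x_def p_def H_def)
  have y: "(2*x - t) * p = - H" using IH nz by simp
  have ynz: "2*x - t \<noteq> 0" using IH nz by simp
  have "2 * newton t u x - t = ((2*x - t)^2 + (t^2 - 4*u)) / (2 * (2*x - t))"
    using ynz by (simp add: newton_def divide_simps) (simp add: algebra_simps power2_eq_square)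
  also have "\<dots> = - (H^2 - 2*w) / (p * H)"
  proof -
    have "((2*x - t)^2 + (t^2 - 4*u)) * (p * H) = - (H^2 - 2*w) * (2 * (2*x - t))"
    proof -
      have "p * (((2*x - t)^2 + (t^2 - 4*u)) * (p * H) + (H^2 - 2*w) * (2 * (2*x - t))) = 0"
        using y id by algebra
      hence "((2*x - t)^2 + (t^2 - 4*u)) * (p * H) + (H^2 - 2*w) * (2 * (2*x - t)) = 0"
        using nz by simp
      thus ?thesis by algebra
    qed
    thus ?thesis using nz ynz by (subst frac_eq_eq) auto
  qed
  finally show ?case by (simp add: p_def H_def w_def x_def)
qed

lemma newton_reflect: "newton t u (t - x) = t - newton t u x" if "2*x - t \<noteq> 0"
proof -
  have "newton t u (t - x) = - (((t - x)^2 - u) / (2*x - t))"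
  proof -
    have "2 * (t - x) - t = - (2*x - t)" by simp
    thus ?thesis unfolding newton_def by (metis minus_divide_right)
  qed
  also have "\<dots> = t - newton t u x"
    using that by (simp add: newton_def divide_simps) (simp add: algebra_simps power2_eq_square)
  finally show ?thesis .
qed

lemma newton_denominators_nonzero:
  assumes "u \<in> {1, -1, \<i>, -\<i>}" "t \<in> gauss_ints - G2 u"
  shows "2 * (newton t u ^^ n) 0 - t \<noteq> 0" "2 * (newton t u ^^ n) t - t \<noteq> 0"
proof -
  show *: "2 * (newton t u ^^ n) 0 - t \<noteq> 0" for n
    using newton_iterate_zero[OF assms, of n] h_nonzero[OF assms] by simp
  have "(newton t u ^^ n) t = t - (newton t u ^^ n) 0"
    by (induction n) (simp_all add: newton_reflect[OF *])
  hence "2 * (newton t u ^^ n) t - t = - (2 * (newton t u ^^ n) 0 - t)"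
    by simp
  thus "2 * (newton t u ^^ n) t - t \<noteq> 0"
    using *[of n] by (metis neg_equal_0_iff_equal)
qed

lemma cfrac_norm_ge_1:
  assumes "\<And>k. 2 \<le> cmod (c k)"
  shows "1 \<le> cmod (cfrac c m)"
  using assms
proof (induction m arbitrary: c)
  case 0
  show ?case using "0.prems"[of 0] by simp
next
  case (Suc m)
  let ?y = "cfrac (\<lambda>k. c (Suc k)) m"
  have "1 \<le> cmod ?y" using Suc by simp
  hence "cmod (1 / ?y) \<le> 1" by (simp add: norm_divide divide_simps)
  moreover have "cmod (c 0) - cmod (1 / ?y) \<le> cmod (cfrac c (Suc m))"
    by (simp only: cfrac.simps norm_diff_ineq)
  ultimately show ?case using Suc.prems[of 0] by linarith
qed

lemma cfrac_denominators_nonzero: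
  assumes "u \<in> {1, -1, \<i>, -\<i>}" "t \<in> gauss_ints - G2 u"
  shows "cfrac (\<lambda>k. a_digit t u (Suc j + k)) m \<noteq> 0"
    and "cfrac (\<lambda>k. b_digit t u (Suc j + k)) m \<noteq> 0"
proof -
  have "2 \<le> cmod (a_digit t u (Suc j + k))" "2 \<le> cmod (b_digit t u (Suc j + k))" for k
    using norm_ge_2[OF assms(2)] norm_unit[OF assms(1)]
    by (simp_all add: a_digit_def b_digit_def norm_mult norm_inverse)
  hence "1 \<le> cmod (cfrac (\<lambda>k. a_digit t u (Suc j + k)) m)"
    "1 \<le> cmod (cfrac (\<lambda>k. b_digit t u (Suc j + k)) m)"
    by (intro cfrac_norm_ge_1; simp)+
  thus "cfrac (\<lambda>k. a_digit t u (Suc j + k)) m \<noteq> 0"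
    "cfrac (\<lambda>k. b_digit t u (Suc j + k)) m \<noteq> 0" by auto
qed

end

theory Submission
  imports Defs
begin

text \<open>
  Let \<open>\<alpha>, \<beta>\<close> be the roots of \<open>X\<^sup>2 - tX + u\<close>, with \<open>|\<alpha>| \<le> |\<beta>|\<close>, so \<open>\<alpha> + \<beta> = t\<close> and \<open>\<alpha>\<beta> = u\<close>.
  By the parallelogram law \<open>2(|\<alpha>|\<^sup>2 + |\<beta>|\<^sup>2) = |t|\<^sup>2 + |t\<^sup>2 - 4u|\<close>, and the exceptional set is
  exactly what is needed to make the right-hand side exceed \<open>17/2\<close>; as \<open>|\<alpha>||\<beta>| = 1\<close> this
  means \<open>|\<alpha>| < 1/2\<close>. Since \<open>1/\<alpha> = u\<^sup>-\<^sup>1t - u\<^sup>-\<^sup>1\<alpha>\<close>, the Hurwitz algorithm then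
  only ever meets the fractional parts \<open>\<plusminus>\<alpha>\<close> and \<open>\<plusminus>u\<^sup>-\<^sup>1\<alpha>\<close>. With \<open>U\<^sub>n = \<beta>\<^sup>n - \<alpha>\<^sup>n\<close>,
  both the convergents and the Newton iterates (for \<open>m + 1 = 2\<^sup>n\<close>) equal
  \<open>u U\<^sub>m / U\<^sub>m\<^sub>+\<^sub>1\<close>, and their distance to \<open>\<alpha>\<close> is
  \<open>|\<alpha>\<^sup>m\<^sup>+\<^sup>1 (\<beta> - \<alpha>) / U\<^sub>m\<^sub>+\<^sub>1|\<close>.
\<close>

section \<open>Gaussian integers and rationals\<close>

lemma gauss_ints_diff: "x \<in> gauss_ints \<Longrightarrow> y \<in> gauss_ints \<Longrightarrow> x - y \<in> gauss_ints"
  by (simp add: gauss_ints_def)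

lemma gauss_ints_uminus: "x \<in> gauss_ints \<Longrightarrow> - x \<in> gauss_ints"
  by (simp add: gauss_ints_def)

lemma gauss_ints_mult: "x \<in> gauss_ints \<Longrightarrow> y \<in> gauss_ints \<Longrightarrow> x * y \<in> gauss_ints"
  by (simp add: gauss_ints_def)

lemma gauss_units_in_gauss_ints:
  "u \<in> {1, -1, \<i>, -\<i>} \<Longrightarrow> u \<in> gauss_ints \<and> inverse u \<in> gauss_ints"
  by (auto simp: gauss_ints_def)

lemma gauss_ints_subset_gauss_rats: "gauss_ints \<subseteq> gauss_rats"
  using Ints_subset_Rats by (auto simp: gauss_ints_def gauss_rats_def)

lemma gauss_rats_diff: "x \<in> gauss_rats \<Longrightarrow> y \<in> gauss_rats \<Longrightarrow> x - y \<in> gauss_rats"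
  by (simp add: gauss_rats_def)

lemma gauss_rats_uminus: "x \<in> gauss_rats \<Longrightarrow> - x \<in> gauss_rats"
  by (simp add: gauss_rats_def)

lemma gauss_rats_inverse: "x \<in> gauss_rats \<Longrightarrow> inverse x \<in> gauss_rats"
  by (simp add: gauss_rats_def)

lemma gauss_rats_mult: "x \<in> gauss_rats \<Longrightarrow> y \<in> gauss_rats \<Longrightarrow> x * y \<in> gauss_rats"
  by (simp add: gauss_rats_def)

lemma gauss_rats_denominator:
  assumes "z \<in> gauss_rats"
  obtains q where "q \<in> gauss_ints" "q \<noteq> 0" "q * z \<in> gauss_ints"
proof -
  obtain a b where ab: "b > 0" "Re z = of_int a / of_int b"
    using assms Rats_cases' unfolding gauss_rats_def by blast
  obtain c d where cd: "d > 0" "Im z = of_int c / of_int d"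
    using assms Rats_cases' unfolding gauss_rats_def by blast
  show ?thesis
  proof
    show "of_int (b * d) \<in> gauss_ints" "of_int (b * d) \<noteq> (0 :: complex)"
      using ab cd by (simp_all add: gauss_ints_def)
    have "Re (of_int (b * d) * z) = of_int (a * d)" "Im (of_int (b * d) * z) = of_int (b * c)"
      using ab cd by simp_all
    thus "of_int (b * d) * z \<in> gauss_ints"
      unfolding gauss_ints_def by (metis (mono_tags, lifting) Ints_of_int mem_Collect_eq)
  qed
qed

text \<open>The squared modulus of a Gaussian integer is a natural number, so its floor loses
  nothing and can serve as the well-founded measure of the descent.\<close>

lemma gauss_ints_cmod_squared_nat:
  assumes "z \<in> gauss_ints"
  shows "(cmod z)\<^sup>2 = real (nat \<lfloor>(cmod z)\<^sup>2\<rfloor>)"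
proof -
  have "(cmod z)\<^sup>2 \<in> \<int>"
    using assms by (auto simp: gauss_ints_def cmod_power2)
  thus ?thesis by (auto elim!: Ints_cases)
qed

text \<open>
  Infinite descent: if \<open>q z\<close> is integral then so is \<open>(q z) z\<close>, so \<open>q z\<close> is a smaller denominator.
\<close>

lemma small_root_not_gauss_rat:
  assumes eq: "z\<^sup>2 - t * z + u = 0" and tu: "t \<in> gauss_ints" "u \<in> gauss_ints" "u \<noteq> 0"
    and small: "cmod z < 1"
  shows "z \<notin> gauss_rats"
proof
  assume "z \<in> gauss_rats"
  then obtain q where "q \<in> gauss_ints" "q \<noteq> 0" "q * z \<in> gauss_ints"
    by (rule gauss_rats_denominator)
  moreover have "\<not> (q \<in> gauss_ints \<and> q \<noteq> 0 \<and> q * z \<in> gauss_ints)" for q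
  proof (induction "nat \<lfloor>(cmod q)\<^sup>2\<rfloor>" arbitrary: q rule: less_induct)
    case less
    show ?case
    proof
      assume q: "q \<in> gauss_ints \<and> q \<noteq> 0 \<and> q * z \<in> gauss_ints"
      have "z \<noteq> 0" using eq tu by auto
      have "q * z * z = t * (q * z) - u * q"
        using eq by algebra
      hence p: "q * z \<in> gauss_ints \<and> q * z \<noteq> 0 \<and> q * z * z \<in> gauss_ints"
        using q tu \<open>z \<noteq> 0\<close> by (simp add: gauss_ints_mult gauss_ints_diff)
      have "cmod (q * z) < cmod q"
        using q small by (simp add: norm_mult)
      hence "(cmod (q * z))\<^sup>2 < (cmod q)\<^sup>2"
        by (simp add: power_strict_mono)
      hence "nat \<lfloor>(cmod (q * z))\<^sup>2\<rfloor> < nat \<lfloor>(cmod q)\<^sup>2\<rfloor>"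
        using gauss_ints_cmod_squared_nat[of q] gauss_ints_cmod_squared_nat[of "q * z"] q
        by linarith
      from less[OF this] p show False by blast
    qed
  qed
  ultimately show False by blast
qed

section \<open>Irreducibility of quadratics over the Gaussian rationals\<close>

lemma poly_unit_over_degree_0:
  assumes "p \<in> polys_over gauss_rats" "degree p = 0" "p \<noteq> 0"
  shows "poly_unit_over gauss_rats p"
proof -
  obtain c where c: "p = [:c:]" using assms(2) by (rule degree_eq_zeroE)
  have "c \<in> gauss_rats" using assms(1) by (auto simp: c polys_over_def dest: spec[of _ 0])
  hence "[:inverse c:] \<in> polys_over gauss_rats"
    using gauss_rats_inverse[of c]
    by (auto simp: polys_over_def coeff_pCons gauss_rats_def split: nat.split)
  moreover have "p * [:inverse c:] = 1" using assms(3) by (simp add: c one_pCons)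
  ultimately show ?thesis using assms(1) unfolding poly_unit_over_def by blast
qed

lemma linear_poly_over_root:
  assumes "p \<in> polys_over gauss_rats" "degree p = 1"
  obtains z where "z \<in> gauss_rats" "poly p z = 0"
proof
  have "coeff p 0 \<in> gauss_rats" "coeff p 1 \<in> gauss_rats"
    using assms(1) by (auto simp: polys_over_def)
  thus "- (coeff p 0 * inverse (coeff p 1)) \<in> gauss_rats"
    by (intro gauss_rats_uminus gauss_rats_mult gauss_rats_inverse)
  have "coeff p 1 \<noteq> 0" using assms(2) by (metis leading_coeff_0_iff degree_0 zero_neq_one)
  thus "poly p (- (coeff p 0 * inverse (coeff p 1))) = 0"
    using assms(2) by (simp add: poly_altdef)
qed

text \<open>The degrees of two factors add up to 2. A linear factor would have its root in the
  field, so one factor is constant and therefore a unit.\<close>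

lemma irreducible_over_quadratic:
  assumes "p \<in> polys_over gauss_rats" "degree p = 2"
    and no_root: "\<And>z. poly p z = 0 \<Longrightarrow> z \<notin> gauss_rats"
  shows "irreducible_over gauss_rats p"
  unfolding irreducible_over_def
proof (intro conjI ballI impI)
  show "p \<in> polys_over gauss_rats" by fact
  show nz: "p \<noteq> 0" using assms(2) by auto
  show "\<not> poly_unit_over gauss_rats p"
  proof
    assume "poly_unit_over gauss_rats p"
    then obtain q where "p * q = 1" by (auto simp: poly_unit_over_def)
    hence "is_unit p" by (metis dvd_triv_left)
    thus False using assms(2) by (simp add: is_unit_iff_degree nz)
  qed
  fix q r assume q: "q \<in> polys_over gauss_rats" and r: "r \<in> polys_over gauss_rats"
    and p: "p = q * r"
  have nz': "q \<noteq> 0" "r \<noteq> 0" using nz p by auto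
  have "degree q + degree r = 2" using assms(2) nz' by (simp add: p degree_mult_eq)
  moreover have "degree q \<noteq> 1"
  proof
    assume "degree q = 1"
    then obtain z where "z \<in> gauss_rats" "poly q z = 0" using linear_poly_over_root q by blast
    thus False using no_root[of z] by (simp add: p)
  qed
  ultimately have "degree q = 0 \<or> degree r = 0" by linarith
  thus "poly_unit_over gauss_rats q \<or> poly_unit_over gauss_rats r"
    using poly_unit_over_degree_0 q r nz' by blast
qed

section \<open>Size of the roots\<close>

text \<open>The bound \<open>17/2\<close> is \<open>2 * (x^2 + 1/x^2)\<close> at
  \<open>x = 1/2\<close>. If the squared modulus of \<open>t\<close> is at least 7, the triangle
  inequality already gives \<open>2 * 7 - 4 = 10\<close>; the finitely many smaller \<open>t\<close>
  are checked one by one.\<close>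

lemma norm_plus_norm_discriminant_gt:
  assumes u: "u \<in> {1, -1, \<i>, -\<i>}" and t: "t \<in> gauss_ints - G2 u"
  shows "17/2 < (cmod t)\<^sup>2 + cmod (t\<^sup>2 - 4 * u)"
proof -
  obtain a b :: int where ab: "Re t = of_int a" "Im t = of_int b"
    using t by (auto simp: gauss_ints_def elim!: Ints_cases)
  have n: "(cmod t)\<^sup>2 = of_int (a\<^sup>2 + b\<^sup>2)"
    by (simp add: cmod_power2 ab)
  show ?thesis
  proof (cases "a\<^sup>2 + b\<^sup>2 \<ge> 7")
    case True
    hence "(cmod t)\<^sup>2 \<ge> 7" using n by linarith
    moreover have "cmod (t\<^sup>2) - cmod (4 * u) \<le> cmod (t\<^sup>2 - 4 * u)"
      by (rule norm_triangle_ineq2)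
    ultimately show ?thesis
      using norm_unit[OF u] by (simp add: norm_mult norm_power)
  next
    case False
    have "\<bar>a\<bar> < 3" "\<bar>b\<bar> < 3"
      using False abs_le_square_iff[of 3 a] abs_le_square_iff[of 3 b]
        zero_le_power2[of a] zero_le_power2[of b] by auto
    hence a: "a \<in> {-2, -1, 0, 1, 2}" and b: "b \<in> {-2, -1, 0, 1, 2}" by auto
    have nG: "t \<notin> G2 u" and nD: "\<not> (a \<in> {-1, 0, 1} \<and> b \<in> {-1, 0, 1})"
      using t ab by (auto simp: G2_def D_set_def)
    \<comment> \<open>Moving the squared modulus of \<open>t\<close> to the left and squaring
      removes the root hidden in \<open>cmod\<close>, so each case is a comparison of rational
      numbers.\<close>
    have "(17/2 - of_int (a\<^sup>2 + b\<^sup>2))\<^sup>2 < (Re (t\<^sup>2 - 4 * u))\<^sup>2 + (Im (t\<^sup>2 - 4 * u))\<^sup>2"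
      using u a b nG nD False ab
      by (auto simp: G2_def complex_eq_iff power2_eq_square)
    hence "(17/2 - of_int (a\<^sup>2 + b\<^sup>2))\<^sup>2 < (cmod (t\<^sup>2 - 4 * u))\<^sup>2"
      by (simp add: cmod_power2)
    hence "17/2 - of_int (a\<^sup>2 + b\<^sup>2) < cmod (t\<^sup>2 - 4 * u)"
      by (rule power2_less_imp_less) simp
    thus ?thesis using n by linarith
  qed
qed

lemma quadratic_roots_ordered:
  obtains \<alpha> \<beta> :: complex where "\<alpha> + \<beta> = t" "\<alpha> * \<beta> = u" "cmod \<alpha> \<le> cmod \<beta>"
proof -
  define d where "d = csqrt (t\<^sup>2 - 4 * u)"
  have "d\<^sup>2 = t\<^sup>2 - 4 * u" by (simp add: d_def)
  hence *: "(t - d) / 2 + (t + d) / 2 = t" "(t - d) / 2 * ((t + d) / 2) = u"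
    by (simp_all add: field_simps power2_eq_square)
  show ?thesis
    \<comment> \<open>The branch chosen by \<open>csqrt\<close> does not determine which root is
      smaller, so both orders are offered.\<close>
    using that[of "(t - d) / 2" "(t + d) / 2"] that[of "(t + d) / 2" "(t - d) / 2"] *
    by (metis add.commute mult.commute linear)
qed

text \<open>If \<open>x \<ge> 1/2\<close>, then \<open>x * y = 1\<close> puts both moduli in
  \<open>[1/2, 2]\<close>. The parallelogram law and \<open>x * y = 1\<close> give
  \<open>x + y > 5/2\<close>, whereas \<open>(2 - x) * (2 - y) \<ge> 0\<close> gives
  \<open>x + y \<le> 5/2\<close>.\<close>

lemma smaller_root_norm_less_half:
  fixes \<alpha> \<beta> :: complex
  assumes "\<alpha> + \<beta> = t" "\<alpha> * \<beta> = u" "cmod \<alpha> \<le> cmod \<beta>" "cmod u = 1"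
    and gt: "17/2 < (cmod t)\<^sup>2 + cmod (t\<^sup>2 - 4 * u)"
  shows "cmod \<alpha> < 1/2"
proof (rule ccontr)
  define x where "x = cmod \<alpha>"
  define y where "y = cmod \<beta>"
  assume "\<not> cmod \<alpha> < 1/2"
  hence x: "x \<ge> 1/2" by (simp add: x_def)
  have xy: "x * y = 1" "x \<le> y" using assms by (simp_all add: x_def y_def flip: norm_mult)
  have "(\<beta> - \<alpha>)\<^sup>2 = t\<^sup>2 - 4 * u"
    unfolding assms(1,2)[symmetric] by (simp add: power2_eq_square algebra_simps)
  hence "cmod (t\<^sup>2 - 4 * u) = (cmod (\<beta> - \<alpha>))\<^sup>2" by (simp flip: norm_power)
  also have "\<dots> + (cmod t)\<^sup>2 = 2 * (x\<^sup>2 + y\<^sup>2)"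
    unfolding assms(1)[symmetric] x_def y_def cmod_power2
    by (simp add: power2_eq_square algebra_simps)
  finally have "17/4 < x\<^sup>2 + y\<^sup>2" using gt by simp
  have "y \<le> 2" using mult_right_mono[OF x, of y] xy by (simp add: y_def)
  have "x \<le> 2" using \<open>y \<le> 2\<close> xy by simp
  have "(x + y)\<^sup>2 > 25/4" using \<open>17/4 < x\<^sup>2 + y\<^sup>2\<close> xy(1) by (simp add: power2_sum)
  hence "(5/2)\<^sup>2 < (x + y)\<^sup>2" by (simp add: power2_eq_square)
  hence "5/2 < x + y" using power2_less_imp_less[of "5/2" "x + y"] x xy by simp
  moreover have "(2 - x) * (2 - y) \<ge> 0" using \<open>y \<le> 2\<close> \<open>x \<le> 2\<close> by simp
  ultimately show False using xy(1) by (simp add: algebra_simps)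
qed

lemma root_quadratic_iff:
  fixes \<alpha> \<beta> :: complex
  assumes "\<alpha> + \<beta> = t" "\<alpha> * \<beta> = u"
  shows "poly (f_poly t u) z = 0 \<longleftrightarrow> z = \<alpha> \<or> z = \<beta>"
proof -
  have "poly (f_poly t u) z = (z - \<alpha>) * (z - \<beta>)"
    unfolding assms[symmetric] by (simp add: f_poly_def algebra_simps)
  thus ?thesis by simp
qed

section \<open>Hurwitz expansions\<close>

text \<open>The open disc of radius 1/2 about \<open>c\<close> lies inside the unit square of points
  that round to \<open>c\<close>.\<close>

lemma gauss_round_eqI:
  assumes "c \<in> gauss_ints" "cmod (z - c) < 1/2"
  shows "gauss_round z = c"
proof -
  obtain a b :: int where ab: "Re c = of_int a" "Im c = of_int b"
    using assms(1) by (auto simp: gauss_ints_def elim!: Ints_cases)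
  have "\<bar>Re z - of_int a\<bar> < 1/2" "\<bar>Im z - of_int b\<bar> < 1/2"
    using abs_Re_le_cmod[of "z - c"] abs_Im_le_cmod[of "z - c"] assms(2) ab by auto
  hence "\<lfloor>Re z + 1/2\<rfloor> = a" "\<lfloor>Im z + 1/2\<rfloor> = b"
    by (auto intro!: floor_unique simp: abs_if split: if_splits)
  thus ?thesis by (simp add: gauss_round_def complex_eq_iff ab)
qed

text \<open>The algorithm is deterministic: proposed digits are the right ones once fractional parts
  \<epsilon> of modulus below 1/2 are exhibited that satisfy its recursion.\<close>

lemma has_hcf_expansionI:
  assumes "z \<notin> gauss_rats" "z = c 0 + \<epsilon> 0"
    and "\<And>n. c n \<in> gauss_ints" "\<And>n. cmod (\<epsilon> n) < 1/2"
    and step: "\<And>n. 1 / \<epsilon> n = c (Suc n) + \<epsilon> (Suc n)"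
  shows "has_hcf_expansion z c"
proof -
  have round: "gauss_round (c n + \<epsilon> n) = c n" for n
    using assms(3,4) by (intro gauss_round_eqI) auto
  have "hcf_remainder z n = c n + \<epsilon> n" for n
    by (induction n) (simp_all add: assms(2) gauss_frac_def round step)
  thus ?thesis by (simp add: has_hcf_expansion_def assms(1) round)
qed

lemma hcf_expansion_roots:
  fixes \<alpha> \<beta> :: complex
  assumes "\<alpha> + \<beta> = t" "\<alpha> * \<beta> = u" "u \<in> {1, -1, \<i>, -\<i>}" "t \<in> gauss_ints"
    and "cmod \<alpha> < 1/2" "\<alpha> \<notin> gauss_rats" "\<beta> \<notin> gauss_rats"
  shows "has_hcf_expansion \<alpha> (a_digit t u)" "has_hcf_expansion \<beta> (b_digit t u)"
proof -
  have nz: "u \<noteq> 0" "\<alpha> \<noteq> 0" using assms(2,3) by auto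
  have u: "cmod u = 1" "u \<in> gauss_ints" "inverse u \<in> gauss_ints"
    using norm_unit gauss_units_in_gauss_ints assms(3) by auto
  have quad: "u + \<alpha> * \<alpha> = \<alpha> * t"
    unfolding assms(1,2)[symmetric] by (simp add: algebra_simps)
  have inv: "1 / \<alpha> = inverse u * t - \<alpha> / u"
    using quad nz by (simp add: field_simps)
  have inv': "u / \<alpha> = t - \<alpha>"
    using quad nz by (simp add: field_simps)
  have z: "0 \<in> gauss_ints" by (simp add: gauss_ints_def)
  show "has_hcf_expansion \<alpha> (a_digit t u)"
    \<comment> \<open>The fractional parts have period 2: inverting \<alpha> leaves
      \<open>- (\<alpha> / u)\<close> by \<open>inv\<close>, and inverting that returns to \<alpha>
      by \<open>inv'\<close>. For \<beta> all signs are reversed, starting from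
      \<open>\<beta> = t - \<alpha>\<close>.\<close>
    by (rule has_hcf_expansionI[where \<epsilon> = "\<lambda>n. if even n then \<alpha> else - (\<alpha> / u)"])
      (use assms u z inv inv' in \<open>auto simp: a_digit_def norm_divide
        intro: gauss_ints_mult gauss_ints_uminus\<close>)
  show "has_hcf_expansion \<beta> (b_digit t u)"
    by (rule has_hcf_expansionI[where \<epsilon> = "\<lambda>n. if even n then - \<alpha> else \<alpha> / u"])
      (use assms u inv inv' in \<open>auto simp: b_digit_def norm_divide
        intro: gauss_ints_mult gauss_ints_uminus\<close>)
qed

section \<open>Convergents and Newton iterates\<close>

lemma power_diff_nonzero:
  fixes \<alpha> \<beta> :: complex
  assumes "cmod \<alpha> < cmod \<beta>" "n > 0"
  shows "\<beta> ^ n - \<alpha> ^ n \<noteq> 0"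
proof -
  have "cmod (\<alpha> ^ n) < cmod (\<beta> ^ n)"
    using assms by (simp add: norm_power power_strict_mono)
  thus ?thesis by auto
qed

lemma cfrac_uminus: "cfrac (\<lambda>k. - c k) m = - cfrac c m"
  by (induction m arbitrary: c) simp_all

text \<open>Up to the factor \<open>\<beta> - \<alpha>\<close>, \<open>U\<close> is the Lucas
  sequence with \<open>U (n + 2) = t * U (n + 1) - u * U n\<close>. Since \<open>cfrac\<close> peels
  digits from the front and the digits have period 2, each claim at \<open>Suc m\<close> needs the
  other at \<open>m\<close>; hence the joint induction.\<close>

lemma cfrac_b_digit:
  fixes \<alpha> \<beta> :: complex
  assumes "\<alpha> + \<beta> = t" "\<alpha> * \<beta> = u" "u \<noteq> 0" "cmod \<alpha> < cmod \<beta>"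
  defines "U \<equiv> \<lambda>n. \<beta> ^ n - \<alpha> ^ n"
  shows "cfrac (b_digit t u) m = U (m + 2) / U (m + 1)"
    and "cfrac (\<lambda>k. b_digit t u (Suc k)) m = - (U (m + 2) / (u * U (m + 1)))"
proof -
  have nz: "U (Suc n) \<noteq> 0" for n
    unfolding U_def using assms(4) by (intro power_diff_nonzero) auto
  have rec: "U (Suc (Suc n)) = t * U (Suc n) - u * U n" for n
    unfolding U_def assms(1,2)[symmetric] by (simp add: algebra_simps)
  have periodic: "(\<lambda>k. b_digit t u (Suc (Suc k))) = b_digit t u"
    by (simp add: fun_eq_iff b_digit_def)
  have U2: "U (Suc (Suc 0)) = t * U (Suc 0)" using rec[of 0] by (simp add: U_def)
  have "cfrac (b_digit t u) m = U (m + 2) / U (m + 1) \<and>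
    cfrac (\<lambda>k. b_digit t u (Suc k)) m = - (U (m + 2) / (u * U (m + 1)))"
  proof (induction m)
    case 0
    show ?case using nz[of 0] assms(3) U2
      by (simp add: b_digit_def divide_inverse)
  next
    case (Suc m)
    have "U (Suc m + 2) = t * U (m + 2) - u * U (m + 1)" using rec[of "m + 1"] by simp
    thus ?case using Suc.IH nz[of m] nz[of "Suc m"] assms(3)
      by (simp add: periodic) (simp add: b_digit_def field_simps)
  qed
  thus "cfrac (b_digit t u) m = U (m + 2) / U (m + 1)"
    "cfrac (\<lambda>k. b_digit t u (Suc k)) m = - (U (m + 2) / (u * U (m + 1)))" by blast+
qed

text \<open>After the leading 0 the digits are the negatives of those of \<beta>, so the fraction is
  the inverse of a negated tail from \<open>cfrac_b_digit\<close>.\<close>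

lemma cfrac_a_digit:
  fixes \<alpha> \<beta> :: complex
  assumes "\<alpha> + \<beta> = t" "\<alpha> * \<beta> = u" "u \<noteq> 0" "cmod \<alpha> < cmod \<beta>"
  shows "cfrac (a_digit t u) m = u * (\<beta> ^ m - \<alpha> ^ m) / (\<beta> ^ (m + 1) - \<alpha> ^ (m + 1))"
proof (cases m)
  case 0
  thus ?thesis by (simp add: a_digit_def)
next
  case (Suc k)
  have "(\<lambda>j. a_digit t u (Suc j)) = (\<lambda>j. - b_digit t u (Suc j))"
    by (simp add: fun_eq_iff a_digit_def b_digit_def)
  thus ?thesis
    using cfrac_b_digit(2)[OF assms, of k]
    by (simp add: Suc cfrac_uminus a_digit_def[of _ _ 0])
qed

text \<open>Squaring \<open>\<beta> ^ 2 ^ n + \<alpha> ^ 2 ^ n\<close> produces the cross term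
  \<open>2 * u ^ 2 ^ n\<close> that the recursion subtracts. The product telescopes by repeated
  difference of squares.\<close>

lemma h_seq_roots:
  fixes \<alpha> \<beta> :: complex
  assumes "\<alpha> + \<beta> = t" "\<alpha> * \<beta> = u"
  shows "h_seq t u n = \<beta> ^ 2 ^ n + \<alpha> ^ 2 ^ n"
    and "(\<Prod>k<n. h_seq t u k) * (\<beta> - \<alpha>) = \<beta> ^ 2 ^ n - \<alpha> ^ 2 ^ n"
proof -
  show h: "h_seq t u n = \<beta> ^ 2 ^ n + \<alpha> ^ 2 ^ n" for n
  proof (induction n)
    case (Suc n)
    have "u ^ 2 ^ n = \<alpha> ^ 2 ^ n * \<beta> ^ 2 ^ n" by (simp add: assms(2)[symmetric] power_mult_distrib)
    thus ?case by (simp add: Suc power2_sum power_mult mult.commute[of 2])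
  qed (simp add: assms(1)[symmetric])
  show "(\<Prod>k<n. h_seq t u k) * (\<beta> - \<alpha>) = \<beta> ^ 2 ^ n - \<alpha> ^ 2 ^ n"
  proof (induction n)
    case (Suc n)
    have sq: "x ^ 2 ^ Suc n = x ^ 2 ^ n * x ^ 2 ^ n" for x :: complex
      by (simp add: mult_2 power_add)
    have "(\<Prod>k<Suc n. h_seq t u k) * (\<beta> - \<alpha>) =
      h_seq t u n * ((\<Prod>k<n. h_seq t u k) * (\<beta> - \<alpha>))" by simp
    also have "\<dots> = (\<beta> ^ 2 ^ n + \<alpha> ^ 2 ^ n) * (\<beta> ^ 2 ^ n - \<alpha> ^ 2 ^ n)"
      by (simp only: Suc.IH) (simp only: h)
    also have "\<dots> = \<beta> ^ 2 ^ Suc n - \<alpha> ^ 2 ^ Suc n"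
      unfolding sq by (simp add: algebra_simps)
    finally show ?case .
  qed simp
qed

context
  fixes t u :: complex
  assumes unit: "u \<in> {1, -1, \<i>, -\<i>}" and t_notin: "t \<in> gauss_ints - G2 u"
begin

text \<open>Each Newton step adds one summand: with \<open>p\<close> the product of the
  \<open>h_seq\<close> values, consecutive iterates differ by
  \<open>(h_n^2 - h_(n+1)) / (2 * p (n + 1))\<close>, which is
  \<open>u ^ 2 ^ n / p (n + 1)\<close>.\<close>

lemma newton_iterate_zero_eq_S_sum: "(newton t u ^^ (n + 1)) 0 = S_sum t u n"
proof -
  define p where "p = (\<lambda>n. \<Prod>k<n. h_seq t u k)"
  have nz: "p n \<noteq> 0" "h_seq t u n \<noteq> 0" for n
    using h_nonzero[OF unit t_notin] by (auto simp: p_def)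
  have it: "(newton t u ^^ n) 0 = (t - h_seq t u n / p n) / 2" for n
    using newton_iterate_zero[OF unit t_notin, of n] by (simp add: p_def field_simps)
  have step: "(newton t u ^^ Suc n) 0 = (newton t u ^^ n) 0 + u ^ 2 ^ n / p (Suc n)" for n
    unfolding it using nz[of n]
    by (simp add: p_def field_simps power2_eq_square)
  have S: "S_sum t u n = (\<Sum>m<Suc n. u ^ 2 ^ m / p (Suc m))" for n
    by (simp add: S_sum_def p_def lessThan_Suc_atMost)
  have "(newton t u ^^ n) 0 = (\<Sum>m<n. u ^ 2 ^ m / p (Suc m))" for n
    by (induction n) (simp, simp only: step sum.lessThan_Suc)
  thus ?thesis by (simp add: S del: funpow.simps)
qed

text \<open>The reflection sending \<open>x\<close> to \<open>t - x\<close> exchanges the two roots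
  and commutes with the Newton map.\<close>

lemma newton_iterate_t: "(newton t u ^^ n) t = t - (newton t u ^^ n) 0"
  by (induction n) (simp_all add: newton_reflect[OF newton_denominators_nonzero(1)[OF unit t_notin]])

text \<open>Equivalently, \<open>(x - \<alpha>) / (x - \<beta>)\<close> equals
  \<open>(\<alpha> / \<beta>) ^ 2 ^ n\<close> at the iterate \<open>x\<close>: in this coordinate
  the Newton map is squaring.\<close>

lemma newton_iterate_zero_roots:
  assumes "\<alpha> + \<beta> = t" "\<alpha> * \<beta> = u" "cmod \<alpha> < cmod \<beta>"
  shows "(newton t u ^^ n) 0 =
    (\<alpha> * \<beta> ^ 2 ^ n - \<beta> * \<alpha> ^ 2 ^ n) / (\<beta> ^ 2 ^ n - \<alpha> ^ 2 ^ n)"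
proof -
  define p where "p = (\<Prod>k<n. h_seq t u k)"
  define A where "A = \<alpha> ^ 2 ^ n"
  define B where "B = \<beta> ^ 2 ^ n"
  have nz: "p \<noteq> 0" "B - A \<noteq> 0" "\<beta> - \<alpha> \<noteq> 0"
    using h_nonzero[OF unit t_notin] power_diff_nonzero[OF assms(3), of "2 ^ n"] assms(3)
    by (auto simp: p_def A_def B_def)
  have p: "p * (\<beta> - \<alpha>) = B - A" and h: "h_seq t u n = B + A"
    using h_seq_roots[OF assms(1,2), of n] by (simp_all add: p_def A_def B_def)
  have "(2 * (newton t u ^^ n) 0 - t) * p = - (B + A)"
    using newton_iterate_zero[OF unit t_notin, of n] nz by (simp add: h flip: p_def)
  hence "2 * ((newton t u ^^ n) 0 * (B - A)) = 2 * (\<alpha> * B - \<beta> * A)"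
    using p assms(1) by algebra
  hence "(newton t u ^^ n) 0 * (B - A) = \<alpha> * B - \<beta> * A"
    by (simp only: mult_cancel_left) simp
  thus ?thesis using nz(2) by (simp add: eq_divide_eq flip: A_def B_def)
qed

lemma newton_iterate_eq_cfrac:
  assumes "\<alpha> + \<beta> = t" "\<alpha> * \<beta> = u" "cmod \<alpha> < cmod \<beta>"
  shows "(newton t u ^^ n) 0 = cfrac (a_digit t u) (2 ^ n - 1)"
    and "(newton t u ^^ n) t = cfrac (b_digit t u) (2 ^ n - 1)"
proof -
  \<comment> \<open>With \<open>2 ^ n = m + 1\<close> and \<open>\<alpha> * \<beta> = u\<close>, the
    numerator of the Newton iterate is \<open>u * (\<beta> ^ m - \<alpha> ^ m)\<close>, as in the
    convergent of index \<open>m\<close>.\<close>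
  obtain m where m: "2 ^ n = Suc m" using gr0_implies_Suc[of "2 ^ n"] by auto
  have u: "u \<noteq> 0" using unit by auto
  have nz: "\<beta> ^ Suc m - \<alpha> ^ Suc m \<noteq> 0" using assms(3) by (intro power_diff_nonzero) auto
  show a: "(newton t u ^^ n) 0 = cfrac (a_digit t u) (2 ^ n - 1)"
    using cfrac_a_digit[OF assms(1,2) u assms(3), of m] newton_iterate_zero_roots[OF assms, of n]
    by (simp add: m assms(2)[symmetric] algebra_simps)
  have rec: "\<beta> ^ (m + 2) - \<alpha> ^ (m + 2) =
      t * (\<beta> ^ (m + 1) - \<alpha> ^ (m + 1)) - u * (\<beta> ^ m - \<alpha> ^ m)"
    unfolding assms(1,2)[symmetric] by (simp add: algebra_simps)
  have "cfrac (b_digit t u) m = t - cfrac (a_digit t u) m"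
    unfolding cfrac_b_digit(1)[OF assms(1,2) u assms(3)] cfrac_a_digit[OF assms(1,2) u assms(3)]
    unfolding rec using nz by (simp add: diff_divide_distrib[where a = "t * _"])
  thus "(newton t u ^^ n) t = cfrac (b_digit t u) (2 ^ n - 1)"
    using a by (simp add: newton_iterate_t m)
qed

end

section \<open>Rate of convergence\<close>

text \<open>\<open>rho t\<close> is the larger solution of \<open>x + 1/x = cmod t\<close>, and the
  triangle inequality bounds \<open>cmod t\<close> by \<open>b + 1/b\<close>. This yields
  \<open>s \<le> b - 1/b\<close>, and averaging the two bounds gives \<open>b\<close>.\<close>

lemma rho_le_norm_larger_root:
  assumes "\<alpha> + \<beta> = t" "cmod \<alpha> * cmod \<beta> = 1" "cmod \<beta> \<ge> 1" "cmod t \<ge> 2"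
  shows "rho t \<le> cmod \<beta>"
proof -
  define b where "b = cmod \<beta>"
  define s where "s = sqrt ((cmod t)\<^sup>2 - 4)"
  have s: "s \<ge> 0" "s\<^sup>2 = (cmod t)\<^sup>2 - 4"
    using power_mono[OF assms(4), of 2] by (simp_all add: s_def)
  have b: "b \<ge> 1" "cmod \<alpha> = 1 / b" using assms(2,3) by (auto simp: b_def eq_divide_eq)
  have t: "cmod t \<le> b + 1 / b"
    using norm_triangle_ineq[of \<alpha> \<beta>] b assms(1) by (simp add: b_def)
  have "(cmod t)\<^sup>2 - 4 \<le> (b + 1 / b)\<^sup>2 - 4" using t by (simp add: power_mono)
  also have "\<dots> = (b - 1 / b)\<^sup>2" using b by (simp add: field_simps power2_eq_square)
  finally have "s\<^sup>2 \<le> (b - 1 / b)\<^sup>2" using s by simp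
  moreover have "b - 1 / b \<ge> 0" using b mult_mono[of 1 b 1 b] by (simp add: field_simps)
  ultimately have "s \<le> b - 1 / b" by (rule power2_le_imp_le)
  thus ?thesis using t by (simp add: rho_def b_def s_def)
qed

text \<open>From \<open>a < 1/2\<close> and \<open>b > 2\<close> the factor
  \<open>\<beta> - \<alpha>\<close> has modulus below \<open>5/4 * b\<close>; from
  \<open>b ^ N > 4\<close> the denominator exceeds \<open>3/4 * b ^ N\<close>. The quotient of the
  constants is \<open>5/3\<close>, below 2.\<close>

lemma norm_error_lt:
  fixes \<alpha> \<beta> :: complex
  assumes "cmod \<alpha> * cmod \<beta> = 1" "cmod \<alpha> < 1/2" "N \<ge> 2"
  shows "cmod (\<alpha> ^ N * (\<beta> - \<alpha>) / (\<beta> ^ N - \<alpha> ^ N)) < 2 / cmod \<beta> ^ (2 * N - 1)"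
proof -
  define a where "a = cmod \<alpha>"
  define b where "b = cmod \<beta>"
  have ab: "a * b = 1" "0 < a" "0 < b" "a < 1/2"
    using assms by (auto simp: a_def b_def zero_less_mult_iff mult_eq_0_iff
      intro!: le_neq_trans)
  have b2: "b > 2"
    using ab mult_strict_right_mono[of a "1/2" b] by simp
  have "cmod (\<beta> - \<alpha>) \<le> b + a" unfolding a_def b_def by (metis norm_triangle_ineq4)
  also have "\<dots> < b * (5/4)" using ab b2 by simp
  finally have num: "cmod (\<beta> - \<alpha>) < b * (5/4)" .
  have "(a * b) ^ N = 1" using ab by simp
  hence abN: "a ^ N * b ^ N = 1" by (simp add: power_mult_distrib)
  have "a ^ N < 1" using ab assms(3) by (simp add: power_less_one_iff)
  have "b ^ N \<ge> b ^ 2" using b2 assms(3) by (intro power_increasing) auto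
  moreover have "b ^ 2 > 4" using power_strict_mono[of 2 b 2] b2 by simp
  ultimately have bN: "b ^ N > 4" by linarith
  have "b ^ N - a ^ N \<le> cmod (\<beta> ^ N - \<alpha> ^ N)"
    using norm_triangle_ineq2[of "\<beta> ^ N" "\<alpha> ^ N"] by (simp add: a_def b_def norm_power)
  hence den: "b ^ N * (3/4) < cmod (\<beta> ^ N - \<alpha> ^ N)" using \<open>a ^ N < 1\<close> bN by linarith
  have "cmod (\<alpha> ^ N * (\<beta> - \<alpha>) / (\<beta> ^ N - \<alpha> ^ N)) =
      a ^ N * cmod (\<beta> - \<alpha>) / cmod (\<beta> ^ N - \<alpha> ^ N)"
    by (simp add: norm_divide norm_mult norm_power a_def)
  also have "\<dots> < a ^ N * (b * (5/4)) / (b ^ N * (3/4))"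
    using num den bN ab by (intro frac_less) (auto intro!: mult_strict_left_mono)
  also have "\<dots> = (5/3) * (b / (b ^ N * b ^ N))"
  proof -
    have "a ^ N = 1 / b ^ N" using abN ab by (simp add: eq_divide_eq)
    thus ?thesis by simp
  qed
  also have "b / (b ^ N * b ^ N) = 1 / b ^ (2 * N - 1)"
  proof -
    have "b ^ N * b ^ N = b * b ^ (2 * N - 1)"
      using assms(3) by (simp add: power_add[symmetric] mult_2 flip: power_Suc)
    thus ?thesis using ab by simp
  qed
  also have "5/3 * (1 / b ^ (2 * N - 1)) \<le> 2 / b ^ (2 * N - 1)"
    using ab by (simp add: field_simps)
  finally show ?thesis by (simp add: b_def)
qed

text \<open>The Gaussian integers of modulus exactly 2 are the four that \<open>G3\<close> adds, so
  here \<open>cmod t > 2\<close> and the square root in \<open>rho\<close> is positive.\<close>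

lemma rho_gt_1:
  assumes "t \<in> gauss_ints - G3 u"
  shows "rho t > 1"
proof -
  have t: "t \<in> gauss_ints" "t \<notin> {2, -2, 2*\<i>, -(2*\<i>)}" "2 \<le> cmod t"
    using assms norm_ge_2[of t u] by (auto simp: G3_def)
  obtain a b :: int where ab: "Re t = of_int a" "Im t = of_int b"
    using t by (auto simp: gauss_ints_def elim!: Ints_cases)
  have "a\<^sup>2 + b\<^sup>2 \<noteq> 4"
  proof
    assume sum: "a\<^sup>2 + b\<^sup>2 = 4"
    have "\<bar>a\<bar> < 3" "\<bar>b\<bar> < 3"
      using sum abs_le_square_iff[of 3 a] abs_le_square_iff[of 3 b]
        zero_le_power2[of a] zero_le_power2[of b] by auto
    hence "a \<in> {-2, -1, 0, 1, 2}" "b \<in> {-2, -1, 0, 1, 2}" by auto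
    thus False using sum t(2) ab by (auto simp: complex_eq_iff)
  qed
  moreover have n: "(cmod t)\<^sup>2 = of_int (a\<^sup>2 + b\<^sup>2)" by (simp add: cmod_power2 ab)
  ultimately have "(cmod t)\<^sup>2 \<noteq> 4" by linarith
  moreover have "(cmod t)\<^sup>2 \<ge> 4" using power_mono[OF t(3), of 2] by simp
  ultimately have "sqrt ((cmod t)\<^sup>2 - 4) > 0" by simp
  from add_le_less_mono[OF t(3) this] show ?thesis by (simp add: rho_def)
qed

lemma newton_iterate_error:
  assumes "u \<in> {1, -1, \<i>, -\<i>}" "t \<in> gauss_ints - G2 u"
    and "\<alpha> + \<beta> = t" "\<alpha> * \<beta> = u" "cmod \<alpha> < 1/2" "rho t > 1" "n \<ge> 1"
  shows "cmod (\<alpha> - (newton t u ^^ n) 0) < 2 / rho t ^ (2 ^ (n + 1) - 1)"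
proof -
  define N :: nat where "N = 2 ^ n"
  have N: "N \<ge> 2" using power_increasing[OF assms(7), of "2::nat"] by (simp add: N_def)
  have ab: "cmod \<alpha> * cmod \<beta> = 1"
    using assms(4) norm_unit[OF assms(1)] by (simp flip: norm_mult)
  have b: "cmod \<beta> \<ge> 1"
    using ab assms(5) mult_right_mono[of "cmod \<alpha>" "1/2" "cmod \<beta>"] by simp
  have lt: "cmod \<alpha> < cmod \<beta>" using b assms(5) by linarith
  have nz: "\<beta> ^ N - \<alpha> ^ N \<noteq> 0" using lt N by (intro power_diff_nonzero) auto
  have "\<alpha> - (newton t u ^^ n) 0 = \<alpha> ^ N * (\<beta> - \<alpha>) / (\<beta> ^ N - \<alpha> ^ N)"
    unfolding newton_iterate_zero_roots[OF assms(1-4) lt] N_def[symmetric]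
    using nz by (simp add: field_simps)
  hence "cmod (\<alpha> - (newton t u ^^ n) 0) < 2 / cmod \<beta> ^ (2 * N - 1)"
    using norm_error_lt[OF ab assms(5) N] by simp
  \<comment> \<open>Replacing \<open>cmod \<beta>\<close> by the smaller \<open>rho t\<close>
    weakens the bound; the exponent \<open>2 * N - 1\<close> is
    \<open>2 ^ (n + 1) - 1\<close>.\<close>
  also have "\<dots> \<le> 2 / rho t ^ (2 * N - 1)"
    using rho_le_norm_larger_root[OF assms(3) ab b norm_ge_2[OF assms(2)]] assms(6)
    by (intro divide_left_mono power_mono mult_pos_pos zero_less_power) auto
  finally show ?thesis by (simp add: N_def)
qed

theorem theorem6p2:
  fixes t u :: complex
  assumes "u \<in> {1, -1, \<i>, -\<i>}"
    and "t \<in> gauss_ints - G2 u"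
  shows "irreducible_over gauss_rats (f_poly t u) \<and>
    (\<exists>\<alpha> \<beta>.
      \<alpha> \<noteq> \<beta> \<and> {z. poly (f_poly t u) z = 0} = {\<alpha>, \<beta>} \<and>
      cmod \<alpha> < 1/2 \<and> cmod (\<beta> - t) < 1/2 \<and>
      has_hcf_expansion \<alpha> (a_digit t u) \<and>
      has_hcf_expansion \<beta> (b_digit t u) \<and>
      (\<forall>n. (newton t u ^^ (n + 1)) 0 = S_sum t u n \<and>
           S_sum t u n = cfrac (a_digit t u) (2^(n + 1) - 1) \<and>
           (newton t u ^^ (n + 1)) t = t - S_sum t u n \<and>
           t - S_sum t u n = cfrac (b_digit t u) (2^(n + 1) - 1)) \<and>
      (t \<in> gauss_ints - G3 u \<longrightarrow>
         rho t > 1 \<and>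
         (\<forall>n\<ge>1. cmod (\<alpha> - (newton t u ^^ n) 0) < 2 / rho t ^ (2^(n + 1) - 1) \<and>
                 cmod (\<beta> - (newton t u ^^ n) t) < 2 / rho t ^ (2^(n + 1) - 1))))"
proof -
  obtain \<alpha> \<beta> where roots: "\<alpha> + \<beta> = t" "\<alpha> * \<beta> = u" and le: "cmod \<alpha> \<le> cmod \<beta>"
    by (rule quadratic_roots_ordered)
  have small: "cmod \<alpha> < 1/2"
    using smaller_root_norm_less_half[OF roots le norm_unit[OF assms(1)]]
      norm_plus_norm_discriminant_gt[OF assms] by simp
  have t: "t \<in> gauss_ints" and u: "u \<in> gauss_ints" "u \<noteq> 0"
    using assms gauss_units_in_gauss_ints by auto
  have "cmod \<alpha> + cmod \<beta> \<ge> 2"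
    using norm_triangle_ineq[of \<alpha> \<beta>] norm_ge_2[OF assms(2)] roots(1) by simp
  hence lt: "cmod \<alpha> < cmod \<beta>" using small by linarith
  have "\<alpha>\<^sup>2 - t * \<alpha> + u = 0"
    unfolding roots[symmetric] by (simp add: power2_eq_square algebra_simps)
  hence \<alpha>: "\<alpha> \<notin> gauss_rats"
    using small_root_not_gauss_rat t u small by simp
  \<comment> \<open>The descent requires modulus below 1, so irrationality of \<beta> is deduced
    from that of \<open>\<alpha> = t - \<beta>\<close>.\<close>
  have \<beta>: "\<beta> \<notin> gauss_rats"
  proof
    assume "\<beta> \<in> gauss_rats"
    hence "t - \<beta> \<in> gauss_rats" using t gauss_ints_subset_gauss_rats gauss_rats_diff by blast
    thus False using \<alpha> by (simp flip: roots(1))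
  qed
  have irr: "irreducible_over gauss_rats (f_poly t u)"
  proof (rule irreducible_over_quadratic)
    show "f_poly t u \<in> polys_over gauss_rats"
      using t u(1) gauss_ints_subset_gauss_rats gauss_rats_uminus
      by (auto simp: f_poly_def polys_over_def coeff_pCons gauss_rats_def split: nat.split)
    show "degree (f_poly t u) = 2" by (simp add: f_poly_def)
    show "z \<notin> gauss_rats" if "poly (f_poly t u) z = 0" for z
      using that root_quadratic_iff[OF roots, of z] \<alpha> \<beta> by auto
  qed
  have sums: "(newton t u ^^ (n + 1)) 0 = S_sum t u n \<and>
      S_sum t u n = cfrac (a_digit t u) (2^(n + 1) - 1) \<and>
      (newton t u ^^ (n + 1)) t = t - S_sum t u n \<and>
      t - S_sum t u n = cfrac (b_digit t u) (2^(n + 1) - 1)" for n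
    unfolding newton_iterate_zero_eq_S_sum[OF assms, symmetric]
      newton_iterate_t[OF assms, symmetric]
    by (intro conjI refl newton_iterate_eq_cfrac[OF assms roots lt])
  have err: "cmod (\<alpha> - (newton t u ^^ n) 0) < 2 / rho t ^ (2^(n + 1) - 1) \<and>
      cmod (\<beta> - (newton t u ^^ n) t) < 2 / rho t ^ (2^(n + 1) - 1)"
    if "t \<in> gauss_ints - G3 u" "n \<ge> 1" for n
  proof -
    \<comment> \<open>By reflection the two errors are negatives of each other, so one estimate
      serves both.\<close>
    have "\<beta> - (newton t u ^^ n) t = - (\<alpha> - (newton t u ^^ n) 0)"
      unfolding newton_iterate_t[OF assms] by (simp add: algebra_simps roots(1))
    thus ?thesis
      using newton_iterate_error[OF assms roots small rho_gt_1[OF that(1)] that(2)]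
      by (simp only: norm_minus_cancel)
  qed
  have \<beta>_t: "cmod (\<beta> - t) < 1/2" using small by (simp flip: roots(1))
  have root_set: "{z. poly (f_poly t u) z = 0} = {\<alpha>, \<beta>}"
    using root_quadratic_iff[OF roots] by auto
  have "\<alpha> \<noteq> \<beta>" using lt by auto
  note main = this root_set small \<beta>_t hcf_expansion_roots[OF roots assms(1) t small \<alpha> \<beta>]
  show ?thesis
    by (intro conjI exI[of _ \<alpha>] exI[of _ \<beta>] allI impI irr main sums rho_gt_1
        err[THEN conjunct1] err[THEN conjunct2])
qed

end
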